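(* Let $\rho,\sigma$ be positive definite density operators on $\mathbb C^d$, and let $P=(P_j)_{j=1}^d$ be a rank-one PVM. Put $t_j=\mathrm{Tr}(\rho P_j)/\mathrm{Tr}(\sigma P_j)$, $$\Gamma_P=\sum_jt_jP_j,\qquad G_P=2\rho-\sigma\Gamma_P-\Gamma_P\sigma,$$ and let $\Gamma_\star$ be the unique Hermitian solution of $\sigma\Gamma_\star+\Gamma_\star\sigma=2\rho$. For the spectral decomposition $\Gamma_P=\sum_{\alpha=1}^mt_\alpha B_\alpha$ with distinct $t_\alpha$, define $$r_P^2=\sum_{\alpha=1}^m\|B_\alpha(\rho-t_\alpha\sigma)B_\alpha\|_2^2,\qquad c_P=\|[\Gamma_P,G_P]\|_2,$$ and, when $m\ge2$, $\delta_P=\min_{\alpha\ne\beta}|t_\alpha-t_\beta|$, $\Delta_P=\max_{\alpha\ne\beta}|t_\alpha-t_\beta|$. (If $m=1$ then $c_P=0$ and every quotient involving $\delta_P$ or $\Delta_P$ below is defined to be zero.) Then $$\frac{4r_P^2+c_P^2/\Delta_P^2}{4\lambda_{\max}(\sigma)}\le D^{\mathbb M}_{h_1}(\rho\Vert\sigma)-F_{h_1}(P)\le\frac{4r_P^2+c_P^2/\delta_P^2}{4\lambda_{\min}(\sigma)}$$ and $$\frac{\sqrt{4r_P^2+c_P^2/\Delta_P^2}}{2\lambda_{\max}(\sigma)}\le\|\Gamma_P-\Gamma_\star\|_2\le\frac{\sqrt{4r_P^2+c_P^2/\delta_P^2}}{2\lambda_{\min}(\sigma)}.$$ Consequently, $r_P=c_P=0$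 if and only if $P$ is globally optimal, i.e. $F_{h_1}(P)=D^{\mathbb M}_{h_1}(\rho\Vert\sigma)$.
   Context: A rank-one PVM on $\mathbb C^d$ is $P=(P_1,\dots,P_d)$, the rank-one projections onto the vectors of an orthonormal basis. $\|\cdot\|_2$ is the Hilbert–Schmidt norm, and $\lambda_{\min},\lambda_{\max}$ are extreme eigenvalues. The generator is $h_1(t)=(t-1)^2$ (the same polynomial on all of $\mathbb R$). For $p_j=\mathrm{Tr}(\rho P_j)$, $q_j=\mathrm{Tr}(\sigma P_j)$, $F_{h_1}(P)=\sum_jq_j(p_j/q_j-1)^2$. The measured divergence is $D^{\mathbb M}_{h_1}(\rho\Vert\sigma)=\sup_M\sum_y\mathrm{Tr}(\sigma M_y)\bigl(\mathrm{Tr}(\rho M_y)/\mathrm{Tr}(\sigma M_y)-1\bigr)^2$, the supremum over all finite POVMs $M=(M_y)$ ($M_y\ge0$, $\sum_yM_y=\mathbf 1$; zero effects contribute $0$). *)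

theory Defs
  imports "HOL-Analysis.Analysis"
begin

text \<open>Operators on \<open>\<complex>\<^sup>d\<close> are matrices \<open>complex^'d^'d\<close> with \<open>d = CARD('d)\<close>. The library inner product on
  \<open>complex^'d\<close> is the real one, so the sesquilinear one is introduced here (conjugate-linear in
  the first argument).\<close>

type_synonym 'd cmat = "complex^'d^'d"

definition cinner :: "complex^'d \<Rightarrow> complex^'d \<Rightarrow> complex" where
  "cinner u v = (\<Sum>i\<in>UNIV. cnj (u $ i) * v $ i)"

definition madj :: "'d::finite cmat \<Rightarrow> 'd cmat" where
  "madj A = (\<chi> i j. cnj (A $ j $ i))"

definition hermitian :: "'d::finite cmat \<Rightarrow> bool" where
  "hermitian A \<longleftrightarrow> madj A = A"

definition psd :: "'d::finite cmat \<Rightarrow> bool" where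
  "psd A \<longleftrightarrow> hermitian A \<and> (\<forall>v. 0 \<le> Re (cinner v (A *v v)))"

definition posdef :: "'d::finite cmat \<Rightarrow> bool" where
  "posdef A \<longleftrightarrow> hermitian A \<and> (\<forall>v. v \<noteq> 0 \<longrightarrow> 0 < Re (cinner v (A *v v)))"

definition density_operator :: "'d::finite cmat \<Rightarrow> bool" where
  "density_operator A \<longleftrightarrow> psd A \<and> trace A = 1"

definition commutator :: "'d::finite cmat \<Rightarrow> 'd cmat \<Rightarrow> 'd cmat" where
  "commutator A B = A ** B - B ** A"

definition hs_norm :: "'d::finite cmat \<Rightarrow> real" where
  "hs_norm A = sqrt (Re (trace (madj A ** A)))"

text \<open>For Hermitian \<open>A\<close> all eigenvalues are real, so restricting to real ones loses nothing.\<close>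

definition real_eigenvalues :: "'d::finite cmat \<Rightarrow> real set" where
  "real_eigenvalues A = {l. \<exists>v. v \<noteq> 0 \<and> A *v v = complex_of_real l *s v}"

definition lambda_min :: "'d::finite cmat \<Rightarrow> real" where
  "lambda_min A = Min (real_eigenvalues A)"

definition lambda_max :: "'d::finite cmat \<Rightarrow> real" where
  "lambda_max A = Max (real_eigenvalues A)"

text \<open>An orthonormal family indexed by \<open>'d\<close> has \<open>d\<close> members and is therefore a basis of \<open>\<complex>\<^sup>d\<close>.\<close>

definition orthonormal_basis :: "('d::finite \<Rightarrow> complex^'d) \<Rightarrow> bool" where
  "orthonormal_basis u \<longleftrightarrow> (\<forall>i j. cinner (u i) (u j) = (if i = j then 1 else 0))"

definition rank_one_proj :: "complex^'d::finite \<Rightarrow> 'd cmat" where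
  "rank_one_proj u = (\<chi> i j. u $ i * cnj (u $ j))"

definition rank_one_pvm :: "('d::finite \<Rightarrow> 'd cmat) \<Rightarrow> bool" where
  "rank_one_pvm P \<longleftrightarrow> (\<exists>u. orthonormal_basis u \<and> (\<forall>j. P j = rank_one_proj (u j)))"

definition povm :: "'y set \<Rightarrow> ('y \<Rightarrow> 'd::finite cmat) \<Rightarrow> bool" where
  "povm Y M \<longleftrightarrow> finite Y \<and> (\<forall>y\<in>Y. psd (M y)) \<and> (\<Sum>y\<in>Y. M y) = mat 1"

definition h1 :: "real \<Rightarrow> real" where
  "h1 t = (t - 1)\<^sup>2"

text \<open>A zero effect contributes \<open>0\<close> because of the factor \<open>Tr(\<sigma> M\<^sub>y)\<close>; for positive definite \<open>\<sigma>\<close>,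
  this factor vanishes only for zero effects.\<close>

definition outcome_divergence ::
    "(real \<Rightarrow> real) \<Rightarrow> 'd::finite cmat \<Rightarrow> 'd cmat \<Rightarrow> 'y set \<Rightarrow> ('y \<Rightarrow> 'd cmat) \<Rightarrow> real" where
  "outcome_divergence h \<rho> \<sigma> Y M =
    (\<Sum>y\<in>Y. Re (trace (\<sigma> ** M y)) * h (Re (trace (\<rho> ** M y)) / Re (trace (\<sigma> ** M y))))"

definition F_pvm ::
    "(real \<Rightarrow> real) \<Rightarrow> 'd::finite cmat \<Rightarrow> 'd cmat \<Rightarrow> ('d \<Rightarrow> 'd cmat) \<Rightarrow> real" where
  "F_pvm h \<rho> \<sigma> P = outcome_divergence h \<rho> \<sigma> UNIV P"

text \<open>Every finite POVM can be relabelled by \<open>{..<n}\<close> for some \<open>n\<close>. The supremum is taken in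
  \<open>ereal\<close>, so that it is meaningful without a prior proof of boundedness.\<close>

definition measured_divergence ::
    "(real \<Rightarrow> real) \<Rightarrow> 'd::finite cmat \<Rightarrow> 'd cmat \<Rightarrow> ereal" where
  "measured_divergence h \<rho> \<sigma> =
    Sup {ereal (outcome_divergence h \<rho> \<sigma> {..<n} M) | (n::nat) M. povm {..<n} M}"

definition t_ratio ::
    "'d::finite cmat \<Rightarrow> 'd cmat \<Rightarrow> ('d \<Rightarrow> 'd cmat) \<Rightarrow> 'd \<Rightarrow> real" where
  "t_ratio \<rho> \<sigma> P j = Re (trace (\<rho> ** P j)) / Re (trace (\<sigma> ** P j))"

definition Gamma_pvm ::
    "'d::finite cmat \<Rightarrow> 'd cmat \<Rightarrow> ('d \<Rightarrow> 'd cmat) \<Rightarrow> 'd cmat" where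
  "Gamma_pvm \<rho> \<sigma> P = (\<Sum>j\<in>UNIV. t_ratio \<rho> \<sigma> P j *\<^sub>R P j)"

definition G_pvm ::
    "'d::finite cmat \<Rightarrow> 'd cmat \<Rightarrow> ('d \<Rightarrow> 'd cmat) \<Rightarrow> 'd cmat" where
  "G_pvm \<rho> \<sigma> P = 2 *\<^sub>R \<rho> - \<sigma> ** Gamma_pvm \<rho> \<sigma> P - Gamma_pvm \<rho> \<sigma> P ** \<sigma>"

definition hermitian_lyapunov_solution :: "'d::finite cmat \<Rightarrow> 'd cmat \<Rightarrow> 'd cmat \<Rightarrow> bool" where
  "hermitian_lyapunov_solution \<rho> \<sigma> X \<longleftrightarrow> hermitian X \<and> \<sigma> ** X + X ** \<sigma> = 2 *\<^sub>R \<rho>"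

definition Gamma_star :: "'d::finite cmat \<Rightarrow> 'd cmat \<Rightarrow> 'd cmat" where
  "Gamma_star \<rho> \<sigma> = (THE X. hermitian_lyapunov_solution \<rho> \<sigma> X)"

text \<open>The spectral decomposition with distinct eigenvalues \<open>s 1, \<dots>, s m\<close> and nonzero, mutually
  orthogonal spectral projections \<open>B 1, \<dots>, B m\<close>; it is unique up to the enumeration of the
  eigenvalues.\<close>

definition spectral_decomposition ::
    "'d::finite cmat \<Rightarrow> nat \<Rightarrow> (nat \<Rightarrow> real) \<Rightarrow> (nat \<Rightarrow> 'd cmat) \<Rightarrow> bool" where
  "spectral_decomposition A m s B \<longleftrightarrow>
     inj_on s {1..m} \<and>
     (\<forall>\<alpha>\<in>{1..m}. hermitian (B \<alpha>) \<and> B \<alpha> ** B \<alpha> = B \<alpha> \<and> B \<alpha> \<noteq> 0) \<and>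
     (\<forall>\<alpha>\<in>{1..m}. \<forall>\<beta>\<in>{1..m}. \<alpha> \<noteq> \<beta> \<longrightarrow> B \<alpha> ** B \<beta> = 0) \<and>
     (\<Sum>\<alpha>=1..m. B \<alpha>) = mat 1 \<and>
     A = (\<Sum>\<alpha>=1..m. s \<alpha> *\<^sub>R B \<alpha>)"

definition r_pvm ::
    "'d::finite cmat \<Rightarrow> 'd cmat \<Rightarrow> nat \<Rightarrow> (nat \<Rightarrow> real) \<Rightarrow> (nat \<Rightarrow> 'd cmat) \<Rightarrow> real" where
  "r_pvm \<rho> \<sigma> m s B =
    sqrt (\<Sum>\<alpha>=1..m. (hs_norm (B \<alpha> ** (\<rho> - s \<alpha> *\<^sub>R \<sigma>) ** B \<alpha>))\<^sup>2)"

definition c_pvm ::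
    "'d::finite cmat \<Rightarrow> 'd cmat \<Rightarrow> ('d \<Rightarrow> 'd cmat) \<Rightarrow> real" where
  "c_pvm \<rho> \<sigma> P = hs_norm (commutator (Gamma_pvm \<rho> \<sigma> P) (G_pvm \<rho> \<sigma> P))"

definition gaps :: "nat \<Rightarrow> (nat \<Rightarrow> real) \<Rightarrow> real set" where
  "gaps m s = {\<bar>s \<alpha> - s \<beta>\<bar> | \<alpha> \<beta>. \<alpha> \<in> {1..m} \<and> \<beta> \<in> {1..m} \<and> \<alpha> \<noteq> \<beta>}"

text \<open>The minimal and maximal gap are meaningful only for \<open>m \<ge> 2\<close>; quotients by them are set to
  \<open>0\<close> otherwise.\<close>

definition gap_min :: "nat \<Rightarrow> (nat \<Rightarrow> real) \<Rightarrow> real" where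
  "gap_min m s = Min (gaps m s)"

definition gap_max :: "nat \<Rightarrow> (nat \<Rightarrow> real) \<Rightarrow> real" where
  "gap_max m s = Max (gaps m s)"

definition gap_quotient :: "nat \<Rightarrow> real \<Rightarrow> real \<Rightarrow> real" where
  "gap_quotient m c g = (if m \<ge> 2 then c\<^sup>2 / g\<^sup>2 else 0)"

end

theory Submission
  imports Defs
begin

text \<open>
  With respect to the Hilbert-Schmidt inner product, \<open>D + 1\<close> is the maximum over Hermitian \<open>\<Gamma>\<close> of
  \<open>2 \<langle>\<rho>, \<Gamma>\<rangle> - \<langle>\<sigma>, \<Gamma>\<^sup>2\<rangle>\<close>: for a POVM \<open>M\<close> one takes \<open>\<Gamma> = \<Sum>\<^sub>y t\<^sub>y M\<^sub>y\<close> and uses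
  \<open>\<Gamma>\<^sup>2 \<le> \<Sum>\<^sub>y t\<^sub>y\<^sup>2 M\<^sub>y\<close>. Completing the square, the maximiser is \<open>\<Gamma>\<^sub>\<star>\<close>, its
  eigenbasis attains \<open>D\<close>, and \<open>D - F(P) = \<langle>\<sigma>, E\<^sup>2\<rangle> = \<langle>E, G\<^sub>P\<rangle> / 2\<close> for \<open>E = \<Gamma>\<^sub>\<star> - \<Gamma>\<^sub>P\<close>, where
  \<open>\<sigma> E + E \<sigma> = G\<^sub>P\<close>. Diagonalising \<open>\<sigma>\<close> bounds both \<open>\<langle>E, G\<^sub>P\<rangle>\<close> and \<open>\<parallel>E\<parallel>\<close> in terms of \<open>\<parallel>G\<^sub>P\<parallel>\<close>.
  In the block decomposition of \<open>G\<^sub>P\<close> along the eigenspaces of \<open>\<Gamma>\<^sub>P\<close>, the diagonal blocks have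
  squared norm \<open>4 r\<^sub>P\<^sup>2\<close> in total, and \<open>[\<Gamma>\<^sub>P, G\<^sub>P]\<close> has as its blocks the off-diagonal ones
  multiplied by the gaps \<open>t\<^sub>\<alpha> - t\<^sub>\<beta>\<close>.
\<close>

subsection \<open>The Hilbert-Schmidt inner product\<close>

lemma bilinear_matrix_mult:
  "bilinear ((**) :: complex^'n^'m \<Rightarrow> complex^'k^'n \<Rightarrow> complex^'k^'m)"
  by (auto simp: bilinear_def linear_iff matrix_add_ldistrib matrix_scalar_ac scalar_matrix_assoc
      matrix_matrix_mult_def vec_eq_iff algebra_simps sum.distrib scaleR_sum_right)

text \<open>Supplies the rules for sums, differences and real scalars on either side of a matrix
  product that the later expansions use.\<close>

interpretation cmat_mult: bounded_bilinear
  "(**) :: complex^'n^'m \<Rightarrow> complex^'k^'n \<Rightarrow> complex^'k^'m"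
  using bilinear_matrix_mult by (simp add: bilinear_conv_bounded_bilinear)

lemma madj_mult: "madj (A ** B) = madj B ** madj A"
  by (simp add: madj_def matrix_matrix_mult_def vec_eq_iff mult.commute)

lemma madj_madj [simp]: "madj (madj A) = A"
  by (simp add: madj_def vec_eq_iff)

lemma linear_madj: "linear madj"
  by (simp add: linear_iff madj_def vec_eq_iff)

lemma madj_mat_1 [simp]: "madj (mat 1) = mat 1"
  by (simp add: madj_def mat_def vec_eq_iff)

lemma inner_complex_eq: "inner z w = Re (cnj z * w)"
  by (simp add: inner_complex_def)

lemma Re_cinner: "Re (cinner u v) = inner u v"
  by (simp add: cinner_def inner_vec_def inner_complex_eq)

text \<open>The library inner product on matrices is the real part of the Hilbert-Schmidt one. For
  Hermitian \<open>A\<close> the adjoint disappears, so outcome probabilities become plain inner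
  products.\<close>

lemma Re_trace_mult: "Re (trace (A ** B)) = inner (madj A) B"
  by (simp add: trace_def matrix_matrix_mult_def inner_vec_def madj_def inner_complex_eq)
    (rule sum.swap)

lemma hs_norm_eq_norm: "hs_norm A = norm A"
  by (simp add: hs_norm_def Re_trace_mult norm_eq_sqrt_inner)

lemma inner_mult_left:
  fixes A B C :: "complex^'n^'n"
  shows "inner (A ** B) C = inner B (madj A ** C)"
  using Re_trace_mult[of "madj B" "madj A ** C"] Re_trace_mult[of "madj B ** madj A" C]
  by (simp add: madj_mult matrix_mul_assoc)

text \<open>Cyclicity of the trace moves the right factor \<open>B\<close> around to the other
  argument; for a left factor, associativity is enough.\<close>

lemma inner_mult_right:
  fixes A B C :: "complex^'n^'n"
  shows "inner (A ** B) C = inner A (C ** madj B)"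
proof -
  have "inner (A ** B) C = Re (trace (madj B ** (madj A ** C)))"
    by (simp add: Re_trace_mult matrix_mul_assoc madj_mult)
  also have "\<dots> = Re (trace ((madj A ** C) ** madj B))"
    by (rule arg_cong[OF trace_mul_sym])
  also have "\<dots> = inner A (C ** madj B)"
    using Re_trace_mult[of "madj A" "C ** madj B"] by (simp add: matrix_mul_assoc)
  finally show ?thesis .
qed

lemma cinner_mult_right: "cinner u (A *v v) = cinner (madj A *v u) v"
  by (simp add: cinner_def madj_def matrix_vector_mult_def sum_distrib_left sum_distrib_right
      mult_ac) (rule sum.swap)

lemma inner_mult_vec: "inner u (A *v v) = inner (madj A *v u) (v :: complex^'n)"
  by (metis Re_cinner cinner_mult_right)

lemma cinner_commute: "cinner v u = cnj (cinner u v)"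
  by (simp add: cinner_def mult.commute)

lemma cinner_scaleR_right: "cinner u (c *\<^sub>R v) = of_real c * cinner u v"
  by (simp add: cinner_def sum_distrib_left) (simp add: scaleR_conv_of_real)

lemma cinner_self: "cinner v v = of_real ((norm v)\<^sup>2)"
proof (rule complex_eqI)
  show "Re (cinner v v) = Re (complex_of_real ((norm v)\<^sup>2))"
    by (simp add: Re_cinner power2_norm_eq_inner)
  show "Im (cinner v v) = Im (complex_of_real ((norm v)\<^sup>2))"
    by (simp add: cinner_def mult.commute)
qed

subsection \<open>The spectral theorem\<close>

text \<open>Rayleigh's principle: the quadratic form of \<open>A\<close> attains its maximum on the
  compact unit sphere of \<open>W\<close>, and a maximiser is an eigenvector. Here
  \<open>subspace\<close> means real subspace, and \<open>inner\<close> is the real inner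
  product.\<close>

lemma hermitian_eigenvector_in_subspace:
  fixes A :: "complex^'n^'n"
  assumes herm: "hermitian A" and W: "subspace W" "W \<noteq> {0}"
    and inv: "\<And>w. w \<in> W \<Longrightarrow> A *v w \<in> W"
  obtains v l where "v \<in> W" "norm v = 1" "A *v v = (l::real) *\<^sub>R v"
proof -
  define S where "S = W \<inter> sphere 0 1"
  have lin: "linear ((*v) A)" by simp
  have scal: "A *v (c *\<^sub>R w) = c *\<^sub>R (A *v w)" for c :: real and w
    by (rule linear_scale[OF lin])
  have "compact S"
    unfolding S_def using closed_subspace[OF W(1)] by (simp add: closed_Int_compact)
  moreover have "S \<noteq> {}"
  proof -
    obtain w where "w \<in> W" "w \<noteq> 0"
      using W subspace_0 by blast
    then have "w /\<^sub>R norm w \<in> S"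
      using W(1) by (simp add: S_def subspace_scale)
    then show ?thesis by blast
  qed
  moreover have "continuous_on S (\<lambda>w. inner w (A *v w))"
    by (intro continuous_intros linear_continuous_on) (simp add: lin linear_conv_bounded_linear[symmetric])
  ultimately obtain v where v: "v \<in> S" and max: "\<And>w. w \<in> S \<Longrightarrow> inner w (A *v w) \<le> inner v (A *v v)"
    by (metis continuous_attains_sup)
  define l where "l = inner v (A *v v)"
  have vW: "v \<in> W" and nv: "norm v = 1" using v by (auto simp: S_def)
  \<comment> \<open>\<open>Q\<close> is positive on \<open>W\<close> and its form vanishes at the maximiser \<open>v\<close>; moving from \<open>v\<close> along \<open>Q v\<close>
    therefore forces \<open>Q v = 0\<close>.\<close>
  define Q where "Q w = l *\<^sub>R w - A *v w" for w
  have Q_nonneg: "0 \<le> inner w (Q w)" if "w \<in> W" for w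
  proof (cases "w = 0")
    case False
    have "w /\<^sub>R norm w \<in> S"
      using W(1) that False by (simp add: S_def subspace_scale)
    from max[OF this] have "inner w (A *v w) / (norm w)\<^sup>2 \<le> l"
      using False by (simp add: l_def scal power2_eq_square divide_simps)
    then show ?thesis
      using False by (simp add: Q_def inner_diff_right divide_simps power2_norm_eq_inner)
  qed (simp add: Q_def)
  have Qv0: "inner v (Q v) = 0"
    using nv by (simp add: Q_def inner_diff_right l_def dot_square_norm)
  define w where "w = Q v"
  have wW: "w \<in> W"
    unfolding w_def Q_def using vW W(1) inv by (simp add: subspace_diff subspace_scale)
  have sym: "inner x (Q y) = inner (Q x) y" for x y
    using herm by (simp add: Q_def hermitian_def inner_mult_vec inner_diff_right inner_diff_left)
  have Qlin: "Q (x - e *\<^sub>R y) = Q x - e *\<^sub>R Q y" for x y and e :: real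
    by (simp add: Q_def scal matrix_vector_mult_diff_distrib algebra_simps)
  have "w = 0"
  proof (rule ccontr)
    assume w0: "w \<noteq> 0"
    \<comment> \<open>\<open>Q_nonneg\<close> at \<open>v - e *\<^sub>R w\<close>: the constant term
      is \<open>Qv0\<close>, and by symmetry of \<open>Q\<close> both cross terms equal
      \<open>- e * inner w w\<close>.\<close>
    have key: "2 * e * inner w w \<le> e * e * inner w (Q w)" for e :: real
    proof -
      have "v - e *\<^sub>R w \<in> W"
        using vW wW W(1) by (simp add: subspace_diff subspace_scale)
      from Q_nonneg[OF this] show ?thesis
        using Qv0 sym[of v w]
        by (simp add: Qlin inner_diff_right inner_diff_left w_def[symmetric] algebra_simps)
    qed
    have pos: "0 < inner w w" using w0 by simp
    define q where "q = inner w (Q w)"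
    \<comment> \<open>The step is short enough for the quadratic term to stay below the linear one;
      the summand \<open>1\<close> keeps the denominator positive when \<open>q = 0\<close>.\<close>
    define e where "e = inner w w / (\<bar>q\<bar> + 1)"
    have "e > 0" using pos by (simp add: e_def add_nonneg_pos)
    with key[of e] have "2 * inner w w \<le> e * q" by (simp add: q_def mult.assoc)
    also have "\<dots> \<le> e * (\<bar>q\<bar> + 1)" using \<open>e > 0\<close> by (intro mult_left_mono) auto
    also have "\<dots> = inner w w" by (simp add: e_def)
    finally show False using pos by simp
  qed
  then have "A *v v = l *\<^sub>R v" by (simp add: w_def Q_def)
  with vW nv that show thesis by blast
qed

text \<open>Induction on the index set: the complement \<open>W\<close> of the eigenvectors found so
  far is invariant because \<open>A\<close> is Hermitian, and it is nonzero while an index is left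
  over, so it contains a further eigenvector. Orthogonality is complex, hence
  \<open>cinner\<close>.\<close>

lemma orthonormal_eigenfamily:
  fixes A :: "complex^'n^'n"
  assumes herm: "hermitian A"
  shows "finite I \<Longrightarrow> \<exists>u (l :: 'n \<Rightarrow> real).
    (\<forall>i\<in>I. \<forall>j\<in>I. cinner (u i) (u j) = (if i = j then 1 else 0)) \<and>
    (\<forall>i\<in>I. A *v u i = l i *\<^sub>R u i)"
proof (induction rule: finite_induct)
  case (insert k I)
  obtain u and l :: "'n \<Rightarrow> real" where
    ortho: "\<forall>i\<in>I. \<forall>j\<in>I. cinner (u i) (u j) = (if i = j then 1 else 0)" and
    eig: "\<forall>i\<in>I. A *v u i = l i *\<^sub>R u i"
    using insert.IH by blast
  define W where "W = {w. \<forall>i\<in>I. cinner (u i) w = 0}"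
  have "subspace W"
    unfolding W_def subspace_def
    by (auto simp: cinner_scaleR_right) (auto simp: cinner_def algebra_simps sum.distrib)
  moreover have "W \<noteq> {0}"
  proof -
    \<comment> \<open>The row with index \<open>k\<close> is free, so the orthogonality conditions form a singular square system.\<close>
    define N :: "complex^'n^'n" where "N = (\<chi> i j. if i \<in> I then cnj (u i $ j) else 0)"
    have "row k N = 0"
      using insert.hyps by (simp add: N_def row_def vec_eq_iff)
    then have "det N = 0" by (rule det_zero_row)
    then have "\<not> (\<exists>M. M ** N = mat 1)"
      by (metis det_I det_mul mult_zero_right zero_neq_one)
    then obtain w where "N *v w = 0" "w \<noteq> 0"
      unfolding matrix_left_invertible_ker by blast
    have "cinner (u i) w = (N *v w) $ i" if "i \<in> I" for i
      using that by (simp add: N_def matrix_vector_mult_def cinner_def)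
    with \<open>N *v w = 0\<close> have "w \<in> W"
      by (simp add: W_def)
    with \<open>w \<noteq> 0\<close> show ?thesis by blast
  qed
  moreover have "A *v w \<in> W" if "w \<in> W" for w
  proof -
    have "cinner (u i) (A *v w) = 0" if i: "i \<in> I" for i
    proof -
      have "cinner (u i) (A *v w) = cnj (cinner w (A *v u i))"
        using herm cinner_commute[of "A *v u i" w] by (simp add: cinner_mult_right hermitian_def)
      also have "\<dots> = 0"
        using \<open>w \<in> W\<close> i by (simp add: eig cinner_scaleR_right W_def cinner_commute[of w])
      finally show ?thesis .
    qed
    then show ?thesis by (simp add: W_def)
  qed
  ultimately obtain v c where v: "v \<in> W" "norm v = 1" "A *v v = (c::real) *\<^sub>R v"
    using hermitian_eigenvector_in_subspace[OF herm] by metis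
  have "cinner (u i) v = 0" "cinner v (u i) = 0" if "i \<in> I" for i
    using v(1) that cinner_commute[of v "u i"] by (auto simp: W_def)
  moreover have "cinner v v = 1" using v(2) by (simp add: cinner_self)
  ultimately show ?case
    using insert.hyps(2) ortho eig v(3)
    by (intro exI[of _ "u(k := v)"] exI[of _ "l(k := c)"]) (simp add: ball_Un)
qed simp

theorem hermitian_spectral_theorem:
  fixes A :: "complex^'n^'n"
  assumes "hermitian A"
  obtains u and l :: "'n \<Rightarrow> real" where "orthonormal_basis u" "\<And>i. A *v u i = l i *\<^sub>R u i"
  using orthonormal_eigenfamily[OF assms, of UNIV] by (auto simp: orthonormal_basis_def)

section \<open>Eigenbases as unitary matrices and as resolutions of the identity\<close>

definition basis_mat :: "('n \<Rightarrow> complex^'n) \<Rightarrow> complex^'n^'n" where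
  "basis_mat u = (\<chi> i j. u j $ i)"

definition real_diag :: "('n \<Rightarrow> real) \<Rightarrow> complex^'n^'n" where
  "real_diag l = (\<chi> i j. if i = j then of_real (l i) else 0)"

lemma basis_mat_unitary:
  assumes "orthonormal_basis u"
  shows "madj (basis_mat u) ** basis_mat u = mat 1" "basis_mat u ** madj (basis_mat u) = mat 1"
proof -
  show "madj (basis_mat u) ** basis_mat u = mat 1"
    using assms by (simp add: orthonormal_basis_def basis_mat_def madj_def mat_def cinner_def
        matrix_matrix_mult_def vec_eq_iff)
  then show "basis_mat u ** madj (basis_mat u) = mat 1"
    by (simp add: matrix_left_right_inverse)
qed

text \<open>Entry by entry this is \<open>U ** madj U = mat 1\<close> for the matrix
  \<open>U\<close> with columns \<open>u i\<close>.\<close>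

lemma sum_rank_one_proj:
  assumes "orthonormal_basis u"
  shows "(\<Sum>i\<in>UNIV. rank_one_proj (u i)) = mat 1"
  using basis_mat_unitary(2)[OF assms]
  by (simp add: basis_mat_def madj_def rank_one_proj_def matrix_matrix_mult_def vec_eq_iff)

lemma mult_rank_one_proj:
  assumes "A *v u = l *\<^sub>R u"
  shows "A ** rank_one_proj u = l *\<^sub>R rank_one_proj u"
proof -
  have "A ** rank_one_proj u = (\<chi> i j. (A *v u) $ i * cnj (u $ j))"
    by (simp add: rank_one_proj_def matrix_matrix_mult_def matrix_vector_mult_def vec_eq_iff
        sum_distrib_right mult.assoc)
  then show ?thesis
    by (simp add: assms rank_one_proj_def vec_eq_iff)
qed

lemma spectral_sum:
  assumes "orthonormal_basis u" "\<And>i. A *v u i = l i *\<^sub>R u i"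
  shows "A = (\<Sum>i\<in>UNIV. l i *\<^sub>R rank_one_proj (u i))"
proof -
  have "A = A ** (\<Sum>i\<in>UNIV. rank_one_proj (u i))"
    by (simp add: sum_rank_one_proj[OF assms(1)])
  also have "\<dots> = (\<Sum>i\<in>UNIV. l i *\<^sub>R rank_one_proj (u i))"
    by (simp add: cmat_mult.sum_right mult_rank_one_proj[OF assms(2)])
  finally show ?thesis .
qed

lemma spectral_diag:
  assumes "orthonormal_basis u" "\<And>i. A *v u i = l i *\<^sub>R u i"
  shows "A ** basis_mat u = basis_mat u ** real_diag l"
proof -
  have "A ** basis_mat u = (\<chi> i j. (A *v u j) $ i)"
    by (simp add: basis_mat_def matrix_matrix_mult_def matrix_vector_mult_def vec_eq_iff)
  then show ?thesis
    by (simp add: assms(2) basis_mat_def real_diag_def matrix_matrix_mult_def vec_eq_iff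
        if_distrib cong: if_cong) (simp add: scaleR_conv_of_real mult.commute)
qed

section \<open>Rank-one projections, positivity and extreme eigenvalues\<close>

lemma cinner_rank_one_proj:
  "cinner v (rank_one_proj u *v v) = of_real ((cmod (cinner u v))\<^sup>2)"
proof -
  have "cinner v (rank_one_proj u *v v) = cinner v u * cinner u v"
    by (simp add: cinner_def rank_one_proj_def matrix_vector_mult_def sum_distrib_left
        sum_distrib_right mult_ac)
      (rule sum.swap)
  then show ?thesis
    by (simp only: cinner_commute[of v u] complex_norm_square mult.commute)
qed

lemma hermitian_rank_one_proj: "hermitian (rank_one_proj u)"
  by (simp add: hermitian_def madj_def rank_one_proj_def vec_eq_iff mult.commute)

lemma psd_rank_one_proj: "psd (rank_one_proj u)"
  by (simp add: psd_def hermitian_rank_one_proj cinner_rank_one_proj del: of_real_power)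

lemma inner_rank_one_proj:
  "inner A (rank_one_proj u) = inner u (A *v u)"
proof -
  have "inner A (rank_one_proj u) = (\<Sum>i\<in>UNIV. \<Sum>j\<in>UNIV. Re (cnj (A $ i $ j) * (u $ i * cnj (u $ j))))"
    by (simp add: inner_vec_def rank_one_proj_def inner_complex_eq)
  also have "\<dots> = (\<Sum>i\<in>UNIV. \<Sum>j\<in>UNIV. Re (cnj (u $ i) * (A $ i $ j * u $ j)))"
    by (intro sum.cong refl) (simp add: algebra_simps)
  also have "\<dots> = inner u (A *v u)"
    by (simp only: inner_vec_def inner_complex_eq matrix_vector_mult_def sum_distrib_left Re_sum vec_lambda_beta)
  finally show ?thesis .
qed

lemma psd_inner_nonneg: "psd A \<Longrightarrow> 0 \<le> inner v (A *v v)"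
  by (simp add: psd_def Re_cinner)

text \<open>Diagonalising \<open>B\<close> writes the pairing as a combination of values of the
  quadratic form of \<open>A\<close>, with the nonnegative eigenvalues of \<open>B\<close> as
  coefficients.\<close>

lemma psd_inner_psd_nonneg:
  assumes "psd A" "psd B"
  shows "0 \<le> inner A B"
proof -
  from assms(2) have "hermitian B" by (simp add: psd_def)
  then obtain u l where u: "orthonormal_basis u" and l: "\<And>i. B *v u i = (l i :: real) *\<^sub>R u i"
    by (rule hermitian_spectral_theorem) blast
  have "0 \<le> l i" for i
  proof -
    have "inner (u i) (u i) = 1"
      using u Re_cinner[of "u i" "u i"] by (simp add: orthonormal_basis_def)
    then show ?thesis
      using psd_inner_nonneg[OF assms(2), of "u i"] by (simp add: l)
  qed
  then have "0 \<le> (\<Sum>i\<in>UNIV. l i * inner (u i) (A *v u i))"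
    by (intro sum_nonneg mult_nonneg_nonneg psd_inner_nonneg assms)
  also have "\<dots> = inner A B"
    by (subst spectral_sum[OF u l]) (simp add: inner_sum_right inner_rank_one_proj)
  finally show ?thesis .
qed


lemma inner_orthonormal_self:
  assumes "orthonormal_basis u"
  shows "inner (u i) (u i) = 1"
  using assms Re_cinner[of "u i" "u i"] by (simp add: orthonormal_basis_def)

lemma orthonormal_nonzero: "orthonormal_basis u \<Longrightarrow> u i \<noteq> 0"
  using inner_orthonormal_self[of u i] by auto

lemma posdef_inner_rank_one_proj: "posdef A \<Longrightarrow> u \<noteq> 0 \<Longrightarrow> 0 < inner A (rank_one_proj u)"
  by (simp add: inner_rank_one_proj posdef_def Re_cinner)

lemma posdef_eigenvalue_pos:
  assumes "posdef A" "v \<noteq> 0" "A *v v = l *\<^sub>R v"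
  shows "0 < l"
proof -
  have "0 < l * inner v v"
    using assms by (metis Re_cinner inner_scaleR_right posdef_def)
  then show ?thesis
    using inner_ge_zero[of v] by (simp add: zero_less_mult_iff)
qed

text \<open>An eigenvector has a nonzero component along some \<open>u i\<close>, and Hermiticity
  then forces its eigenvalue to be \<open>l i\<close>. Thus \<open>lambda_min\<close> and
  \<open>lambda_max\<close> are extrema of a finite nonempty set.\<close>

lemma real_eigenvalues_eq_range:
  assumes u: "orthonormal_basis u" and eig: "\<And>i. A *v u i = l i *\<^sub>R u i"
    and herm: "hermitian A"
  shows "real_eigenvalues A = range l"
proof (intro equalityI subsetI)
  have scale: "complex_of_real c *s v = c *\<^sub>R v" for c :: real and v :: "complex^'a"
    by (simp add: vec_eq_iff) (simp add: scaleR_conv_of_real)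
  fix c assume "c \<in> real_eigenvalues A"
  then obtain v where v: "v \<noteq> 0" "A *v v = c *\<^sub>R v"
    by (auto simp: real_eigenvalues_def scale)
  obtain i where i: "cinner (u i) v \<noteq> 0"
  proof -
    have "\<exists>i. cinner (u i) v \<noteq> 0"
    proof (rule ccontr)
      assume "\<not> ?thesis"
      then have "madj (basis_mat u) *v v = 0"
        by (simp add: vec_eq_iff matrix_vector_mult_def madj_def basis_mat_def cinner_def)
      then have "basis_mat u *v (madj (basis_mat u) *v v) = 0" by simp
      then show False
        using v(1) by (simp add: matrix_vector_mul_assoc basis_mat_unitary[OF u])
    qed
    then show thesis using that by blast
  qed
  have "of_real c * cinner (u i) v = cinner (u i) (A *v v)"
    by (simp add: v(2) cinner_scaleR_right)
  also have "\<dots> = cnj (cinner v (l i *\<^sub>R u i))"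
    using herm by (simp add: cinner_mult_right hermitian_def eig cinner_commute[of v])
  also have "\<dots> = of_real (l i) * cinner (u i) v"
    by (simp add: cinner_scaleR_right cinner_commute[of v])
  finally show "c \<in> range l" using i by simp
next
  fix c assume "c \<in> range l"
  then obtain i where c: "c = l i" by blast
  have "A *v u i = complex_of_real c *s u i"
    unfolding eig c by (simp add: vec_eq_iff) (simp add: scaleR_conv_of_real)
  then show "c \<in> real_eigenvalues A"
    using orthonormal_nonzero[OF u] by (auto simp: real_eigenvalues_def)
qed

subsection \<open>The Lyapunov equation\<close>

lemma inner_unitary_conj:
  assumes "U ** madj U = mat 1"
  shows "inner (madj U ** A ** U) (madj U ** B ** U) = inner A B"
proof -
  have "inner (madj U ** A ** U) (madj U ** B ** U) = inner A ((U ** madj U) ** B ** (U ** madj U))"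
    by (simp add: inner_mult_right[of "madj U ** A" U] inner_mult_left[of "madj U" A]
        matrix_mul_assoc)
  then show ?thesis by (simp add: assms)
qed

lemma real_diag_mult: "(real_diag l ** Z) $ i $ j = of_real (l i) * Z $ i $ j"
  by (simp add: matrix_matrix_mult_def real_diag_def if_distrib[of "\<lambda>x. x * _"] cong: if_cong)

lemma mult_real_diag: "(Z ** real_diag l) $ i $ j = of_real (l j) * Z $ i $ j"
  by (simp add: matrix_matrix_mult_def real_diag_def if_distrib[of "\<lambda>x. _ * x"] cong: if_cong)

text \<open>Conjugation by the eigenbasis turns \<open>S\<close> into \<open>real_diag l\<close>,
  which scales rows from the left and columns from the right.\<close>

lemma spectral_conj_anticommutator:
  assumes u: "orthonormal_basis u" and eig: "\<And>i. S *v u i = l i *\<^sub>R u i" and herm: "hermitian S"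
  shows "madj (basis_mat u) ** (S ** E + E ** S) ** basis_mat u =
    (\<chi> i j. of_real (l i + l j) * (madj (basis_mat u) ** E ** basis_mat u) $ i $ j)"
proof -
  let ?U = "basis_mat u" and ?D = "real_diag l"
  have SU: "S ** ?U = ?U ** ?D" by (rule spectral_diag[OF u eig])
  have "madj ?D = ?D" by (simp add: madj_def real_diag_def vec_eq_iff)
  then have US: "madj ?U ** S = ?D ** madj ?U"
    using arg_cong[OF SU, of madj] herm by (simp add: madj_mult hermitian_def)
  have "madj ?U ** (S ** E + E ** S) ** ?U = (madj ?U ** S) ** E ** ?U + madj ?U ** E ** (S ** ?U)"
    by (simp add: cmat_mult.add_left cmat_mult.add_right matrix_mul_assoc)
  also have "\<dots> = ?D ** (madj ?U ** E ** ?U) + (madj ?U ** E ** ?U) ** ?D"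
    by (simp add: SU US matrix_mul_assoc)
  also have "\<dots> = (\<chi> i j. of_real (l i + l j) * (madj ?U ** E ** ?U) $ i $ j)"
    by (simp add: vec_eq_iff real_diag_mult mult_real_diag algebra_simps)
  finally show ?thesis .
qed

text \<open>In an eigenbasis of \<open>S\<close> the map \<open>E \<mapsto> S E + E S\<close> multiplies the entry \<open>(i, j)\<close> by \<open>l i + l j\<close>.\<close>

lemma anticommutator_bounds:
  fixes S E G :: "complex^'n^'n"
  assumes u: "orthonormal_basis u" and eig: "\<And>i. S *v u i = l i *\<^sub>R u i" and herm: "hermitian S"
    and lo: "\<And>i. lo \<le> l i" "0 \<le> lo" and hi: "\<And>i. l i \<le> hi"
  defines "G \<equiv> S ** E + E ** S"
  shows "(norm G)\<^sup>2 \<le> 2 * hi * inner E G" "2 * lo * inner E G \<le> (norm G)\<^sup>2"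
    "norm G \<le> 2 * hi * norm E" "2 * lo * norm E \<le> norm G"
proof -
  define U where "U = basis_mat u"
  define Z where "Z = madj U ** E ** U"
  define w where "w i j = l i + l j" for i j
  define e where "e i j = (cmod (Z $ i $ j))\<^sup>2" for i j
  have UU: "U ** madj U = mat 1" unfolding U_def by (rule basis_mat_unitary[OF u])
  have G': "madj U ** G ** U = (\<chi> i j. of_real (w i j) * Z $ i $ j)"
    unfolding G_def Z_def U_def w_def by (rule spectral_conj_anticommutator[OF u eig herm])
  have w: "2 * lo \<le> w i j" "w i j \<le> 2 * hi" "0 \<le> w i j" for i j
    using lo(1)[of i] lo(1)[of j] hi[of i] hi[of j] lo(2) by (auto simp: w_def)
  have e: "0 \<le> e i j" for i j by (simp add: e_def)
  have ip: "inner (c * z) (d * z) = Re (cnj c * d) * (cmod z)\<^sup>2" for c d z :: complex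
    by (simp add: inner_complex_def cmod_power2) (simp add: algebra_simps power2_eq_square)
  \<comment> \<open>The three quantities are sums of the same nonnegative \<open>e i j\<close> with
    weights \<open>1\<close>, \<open>w i j\<close> and \<open>(w i j)\<^sup>2\<close>. As
    \<open>w i j\<close> lies between \<open>2 * lo\<close> and \<open>2 * hi\<close>, all four
    bounds follow termwise.\<close>
  have EE: "(norm E)\<^sup>2 = (\<Sum>i\<in>UNIV. \<Sum>j\<in>UNIV. e i j)"
    unfolding power2_norm_eq_inner inner_unitary_conj[OF UU, of E E, symmetric]
    by (simp add: Z_def[symmetric] inner_vec_def e_def power2_norm_eq_inner)
  have EG: "inner E G = (\<Sum>i\<in>UNIV. \<Sum>j\<in>UNIV. w i j * e i j)"
    unfolding inner_unitary_conj[OF UU, of E G, symmetric] G'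
    using ip[of 1] by (simp add: Z_def[symmetric] inner_vec_def e_def)
  have GG: "(norm G)\<^sup>2 = (\<Sum>i\<in>UNIV. \<Sum>j\<in>UNIV. (w i j)\<^sup>2 * e i j)"
    unfolding power2_norm_eq_inner inner_unitary_conj[OF UU, of G G, symmetric] G'
    by (simp add: inner_vec_def e_def ip power2_eq_square)
  \<comment> \<open>\<open>undefined\<close> is just some index: the index type is nonempty.\<close>
  have hi0: "0 \<le> hi" using lo(1)[of undefined] lo(2) hi[of undefined] by simp
  show "(norm G)\<^sup>2 \<le> 2 * hi * inner E G" "2 * lo * inner E G \<le> (norm G)\<^sup>2"
    unfolding GG EG sum_distrib_left
    by (intro sum_mono; simp add: power2_eq_square mult.assoc[symmetric];
        intro mult_right_mono w e)+
  have "(norm G)\<^sup>2 \<le> (2 * hi * norm E)\<^sup>2"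
    unfolding GG power_mult_distrib[of _ "norm E"] EE sum_distrib_left
    by (intro sum_mono mult_right_mono power_mono w e)
  then show "norm G \<le> 2 * hi * norm E"
    using hi0 by (simp add: power2_le_iff_abs_le)
  have "(2 * lo * norm E)\<^sup>2 \<le> (norm G)\<^sup>2"
    unfolding GG power_mult_distrib[of _ "norm E"] EE sum_distrib_left
    by (intro sum_mono mult_right_mono power_mono w e) (use lo in auto)
  then show "2 * lo * norm E \<le> norm G"
    using lo by (simp add: power2_le_iff_abs_le)
qed

text \<open>The lower norm bound with the least eigenvalue of \<open>S\<close>, which is positive,
  excludes a kernel.\<close>

lemma posdef_anticommutator_inj:
  assumes "posdef S" "S ** E + E ** S = 0"
  shows "E = 0"
proof -
  have herm: "hermitian S" using assms(1) by (simp add: posdef_def)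
  then obtain u l where u: "orthonormal_basis u" and eig: "\<And>i. S *v u i = (l i :: real) *\<^sub>R u i"
    by (rule hermitian_spectral_theorem) blast
  define lo where "lo = Min (range l)"
  have lo: "lo \<le> l i" for i by (simp add: lo_def)
  have "lo \<in> range l" unfolding lo_def by (rule Min_in) auto
  then have "0 < lo"
    using posdef_eigenvalue_pos[OF assms(1) orthonormal_nonzero[OF u] eig] by auto
  have "2 * lo * norm E \<le> norm (S ** E + E ** S)"
    by (rule anticommutator_bounds(4)[OF u eig herm lo, where hi = "Max (range l)"])
      (use \<open>0 < lo\<close> in auto)
  with \<open>0 < lo\<close> assms(2) show ?thesis
    by (simp add: mult_le_0_iff)
qed

text \<open>In an eigenbasis of \<open>S\<close> the equation decouples into scalar ones, solved by
  dividing by \<open>l i + l j > 0\<close>.\<close>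

lemma posdef_lyapunov_ex1:
  assumes "posdef S" "hermitian R"
  shows "\<exists>!X. hermitian_lyapunov_solution R S X"
proof -
  have herm: "hermitian S" using assms(1) by (simp add: posdef_def)
  then obtain u l where u: "orthonormal_basis u" and eig: "\<And>i. S *v u i = (l i :: real) *\<^sub>R u i"
    by (rule hermitian_spectral_theorem) blast
  have lpos: "0 < l i" for i
    by (rule posdef_eigenvalue_pos[OF assms(1) orthonormal_nonzero[OF u] eig])
  let ?U = "basis_mat u"
  define R' where "R' = madj ?U ** R ** ?U"
  define Z where "Z = (\<chi> i j. 2 * R' $ i $ j / of_real (l i + l j))"
  define X where "X = ?U ** Z ** madj ?U"
  note UU = basis_mat_unitary[OF u]
  have conj: "?U ** (madj ?U ** A ** ?U) ** madj ?U = A" for A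
  proof -
    have "?U ** (madj ?U ** A ** ?U) ** madj ?U = (?U ** madj ?U) ** A ** (?U ** madj ?U)"
      by (simp only: matrix_mul_assoc)
    then show ?thesis by (simp add: UU)
  qed
  have "madj ?U ** X ** ?U = (madj ?U ** ?U) ** Z ** (madj ?U ** ?U)"
    unfolding X_def by (simp only: matrix_mul_assoc)
  then have Z: "madj ?U ** X ** ?U = Z" by (simp add: UU)
  have nz: "complex_of_real (l i) + complex_of_real (l j) \<noteq> 0" for i j
    using lpos[of i] lpos[of j] by (metis add_pos_pos of_real_add of_real_eq_0_iff less_irrefl)
  have "madj ?U ** (S ** X + X ** S) ** ?U = 2 *\<^sub>R R'"
    unfolding spectral_conj_anticommutator[OF u eig herm] Z
    using nz by (simp add: vec_eq_iff Z_def) (simp add: scaleR_conv_of_real)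
  also have "\<dots> = madj ?U ** (2 *\<^sub>R R) ** ?U"
    by (simp add: R'_def cmat_mult.scaleR_left cmat_mult.scaleR_right)
  finally have sol: "S ** X + X ** S = 2 *\<^sub>R R"
    by (metis conj)
  have uniq: "Y = X" if "S ** Y + Y ** S = 2 *\<^sub>R R" for Y
  proof -
    have "S ** (Y - X) + (Y - X) ** S = 0"
      using that sol by (simp add: cmat_mult.diff_left cmat_mult.diff_right algebra_simps)
    from posdef_anticommutator_inj[OF assms(1) this] show ?thesis by simp
  qed
  \<comment> \<open>\<open>madj X\<close> solves the same equation, and \<open>uniq\<close> covers
    arbitrary solutions; hence \<open>X\<close> is Hermitian.\<close>
  have "S ** madj X + madj X ** S = madj (S ** X + X ** S)"
    using herm by (simp add: linear_add[OF linear_madj] madj_mult hermitian_def add.commute)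
  also have "\<dots> = 2 *\<^sub>R R"
    using assms(2) by (simp add: sol linear_scale[OF linear_madj] hermitian_def)
  finally have "madj X = X" by (rule uniq)
  with sol have "hermitian_lyapunov_solution R S X"
    by (simp add: hermitian_lyapunov_solution_def hermitian_def)
  with uniq show ?thesis
    by (auto simp: hermitian_lyapunov_solution_def)
qed

subsection \<open>The measured divergence\<close>

text \<open>Pairing the Lyapunov equation with \<open>Y\<close> expresses
  \<open>2 * inner R Y\<close> through \<open>inner S (Y ** X)\<close> and
  \<open>inner S (X ** Y)\<close>. With \<open>Y = \<Gamma>\<close> this is the cross term of the
  square; with \<open>Y = X\<close> it cancels the constant terms.\<close>

lemma variational_identity:
  assumes X: "hermitian_lyapunov_solution R S X" and "hermitian \<Gamma>"
  shows "2 * inner R \<Gamma> - inner S (\<Gamma> ** \<Gamma>) = inner R X - inner S ((X - \<Gamma>) ** (X - \<Gamma>))"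
proof -
  have mX: "madj X = X" and sol: "S ** X + X ** S = 2 *\<^sub>R R"
    using X by (auto simp: hermitian_lyapunov_solution_def hermitian_def)
  have *: "2 * inner R Y = inner S (Y ** X) + inner S (X ** Y)" for Y
  proof -
    have "2 * inner R Y = inner (S ** X + X ** S) Y" by (simp add: sol)
    also have "\<dots> = inner S (Y ** X) + inner S (X ** Y)"
      by (simp add: inner_add_left inner_mult_right[of S X] inner_mult_left[of X S] mX)
    finally show ?thesis .
  qed
  have "2 * inner R X = 2 * inner S (X ** X)" using *[of X] by simp
  with *[of \<Gamma>] show ?thesis
    by (simp add: cmat_mult.diff_left cmat_mult.diff_right inner_diff_right)
qed

lemma outcome_divergence_inner:
  assumes "hermitian R" "hermitian S"
  shows "outcome_divergence h R S Y M =
    (\<Sum>y\<in>Y. inner S (M y) * h (inner R (M y) / inner S (M y)))"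
  using assms by (simp add: outcome_divergence_def Re_trace_mult hermitian_def)

lemma density_inner_mat_1:
  assumes "density_operator R"
  shows "inner R (mat 1) = 1"
  using assms Re_trace_mult[of R "mat 1"]
  by (simp add: density_operator_def psd_def hermitian_def)

lemma psd_conj:
  assumes "psd A"
  shows "psd (madj C ** A ** C)"
  unfolding psd_def
proof (intro conjI allI)
  show "hermitian (madj C ** A ** C)"
    using assms by (simp add: psd_def hermitian_def madj_mult matrix_mul_assoc)
  fix v
  have "inner v ((madj C ** A ** C) *v v) = inner (C *v v) (A *v (C *v v))"
    using inner_mult_vec[of v "madj C" "A *v (C *v v)"]
    by (simp add: matrix_vector_mul_assoc matrix_mul_assoc)
  then show "0 \<le> Re (cinner v ((madj C ** A ** C) *v v))"
    using psd_inner_nonneg[OF assms] by (simp add: Re_cinner)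
qed

text \<open>Two nonnegative terms are dropped: the defect in the operator inequality for
  \<open>\<Gamma> ** \<Gamma>\<close>, and the square in
  \<open>variational_identity\<close>.\<close>

lemma povm_divergence_le:
  assumes R: "density_operator R" and S: "density_operator S"
    and M: "povm Y M" and X: "hermitian_lyapunov_solution R S X"
  shows "outcome_divergence h1 R S Y M \<le> inner R X - 1"
proof -
  have herm: "hermitian R" "hermitian S" and psd: "psd S"
    using R S by (auto simp: density_operator_def psd_def)
  have fin: "finite Y" and pM: "\<And>y. y \<in> Y \<Longrightarrow> psd (M y)" and sum1: "(\<Sum>y\<in>Y. M y) = mat 1"
    using M by (auto simp: povm_def)
  define p where "p y = inner R (M y)" for y
  define q where "q y = inner S (M y)" for y
  \<comment> \<open>The value \<open>1\<close> at \<open>q y = 0\<close> makes \<open>term_eq\<close> below hold without knowing \<open>p y = 0\<close>.\<close>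
  define t where "t y = (if q y = 0 then 1 else p y / q y)" for y
  define \<Gamma> where "\<Gamma> = (\<Sum>y\<in>Y. t y *\<^sub>R M y)"
  have mM: "madj (M y) = M y" if "y \<in> Y" for y
    using pM[OF that] by (simp add: psd_def hermitian_def)
  have m\<Gamma>: "madj \<Gamma> = \<Gamma>"
    by (simp add: \<Gamma>_def linear_sum[OF linear_madj] linear_scale[OF linear_madj] mM)
  have sump: "(\<Sum>y\<in>Y. p y) = 1" and sumq: "(\<Sum>y\<in>Y. q y) = 1"
    unfolding p_def q_def inner_sum_right[symmetric] sum1 using R S
    by (simp_all add: density_inner_mat_1)
  \<comment> \<open>Rewriting \<open>p\<^sup>2 / q\<close> as
    \<open>2 * t * p - t\<^sup>2 * q\<close> makes each summand linear in the effect once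
    \<open>t\<close> is fixed; the remaining \<open>- 2 * p + q\<close> sums to
    \<open>-1\<close>.\<close>
  have term_eq: "q y * h1 (p y / q y) = 2 * (t y * p y) - (t y)\<^sup>2 * q y - 2 * p y + q y" for y
    by (cases "q y = 0") (auto simp: t_def h1_def field_simps power2_eq_square)
  have "outcome_divergence h1 R S Y M
      = 2 * (\<Sum>y\<in>Y. t y * p y) - (\<Sum>y\<in>Y. (t y)\<^sup>2 * q y) - 2 * (\<Sum>y\<in>Y. p y) + (\<Sum>y\<in>Y. q y)"
    by (simp add: outcome_divergence_inner[OF herm] p_def[symmetric] q_def[symmetric] term_eq
        sum.distrib sum_subtractf sum_distrib_left)
  also have "\<dots> = 2 * inner R \<Gamma> - inner S (\<Sum>y\<in>Y. (t y)\<^sup>2 *\<^sub>R M y) - 1"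
    unfolding sump sumq by (simp add: \<Gamma>_def inner_sum_right p_def q_def)
  also have "\<dots> \<le> 2 * inner R \<Gamma> - inner S (\<Gamma> ** \<Gamma>) - 1"
  proof -
    \<comment> \<open>Each effect is conjugated by its own deviation from \<open>\<Gamma>\<close>.
      Expanding and using that the effects sum to \<open>mat 1\<close> collapses the last three
      terms to \<open>- \<Gamma> ** \<Gamma>\<close>.\<close>
    have "0 \<le> (\<Sum>y\<in>Y. inner S ((t y *\<^sub>R mat 1 - \<Gamma>) ** M y ** (t y *\<^sub>R mat 1 - \<Gamma>)))"
    proof (intro sum_nonneg psd_inner_psd_nonneg psd)
      fix y assume "y \<in> Y"
      have "madj (t y *\<^sub>R mat 1 - \<Gamma>) = t y *\<^sub>R mat 1 - \<Gamma>"
        by (simp add: linear_diff[OF linear_madj] linear_scale[OF linear_madj] m\<Gamma>)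
      then show "psd ((t y *\<^sub>R mat 1 - \<Gamma>) ** M y ** (t y *\<^sub>R mat 1 - \<Gamma>))"
        using psd_conj[OF pM[OF \<open>y \<in> Y\<close>], of "t y *\<^sub>R mat 1 - \<Gamma>"] by simp
    qed
    also have "\<dots> = inner S (\<Sum>y\<in>Y. (t y)\<^sup>2 *\<^sub>R M y - (t y *\<^sub>R M y) ** \<Gamma> - \<Gamma> ** (t y *\<^sub>R M y)
        + \<Gamma> ** M y ** \<Gamma>)"
      unfolding inner_sum_right[symmetric]
      by (simp add: cmat_mult.diff_left cmat_mult.diff_right cmat_mult.scaleR_left
          cmat_mult.scaleR_right power2_eq_square algebra_simps)
    also have "(\<Sum>y\<in>Y. (t y)\<^sup>2 *\<^sub>R M y - (t y *\<^sub>R M y) ** \<Gamma> - \<Gamma> ** (t y *\<^sub>R M y) + \<Gamma> ** M y ** \<Gamma>)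
        = (\<Sum>y\<in>Y. (t y)\<^sup>2 *\<^sub>R M y) - (\<Sum>y\<in>Y. t y *\<^sub>R M y) ** \<Gamma> - \<Gamma> ** (\<Sum>y\<in>Y. t y *\<^sub>R M y)
        + \<Gamma> ** (\<Sum>y\<in>Y. M y) ** \<Gamma>"
      by (simp only: sum.distrib sum_subtractf cmat_mult.sum_left cmat_mult.sum_right)
    also have "\<dots> = (\<Sum>y\<in>Y. (t y)\<^sup>2 *\<^sub>R M y) - \<Gamma> ** \<Gamma>"
      by (simp add: sum1 \<Gamma>_def[symmetric])
    finally show ?thesis by (simp add: inner_diff_right)
  qed
  also have "\<dots> \<le> inner R X - 1"
  proof -
    have "hermitian X" using X by (simp add: hermitian_lyapunov_solution_def)
    then have "madj (X - \<Gamma>) = X - \<Gamma>"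
      by (simp add: linear_diff[OF linear_madj] m\<Gamma> hermitian_def)
    moreover have "psd (mat 1)"
      by (simp add: psd_def hermitian_def Re_cinner)
    ultimately have "psd ((X - \<Gamma>) ** (X - \<Gamma>))"
      using psd_conj[of "mat 1" "X - \<Gamma>"] by simp
    then have "0 \<le> inner S ((X - \<Gamma>) ** (X - \<Gamma>))"
      by (rule psd_inner_psd_nonneg[OF psd])
    then show ?thesis
      using variational_identity[OF X, of \<Gamma>] m\<Gamma> by (simp add: hermitian_def)
  qed
  finally show ?thesis .
qed

section \<open>Rank-one measurements and attainment of the supremum\<close>

lemma rank_one_proj_mult:
  "rank_one_proj u ** rank_one_proj v = (\<chi> i j. cinner u v * (u $ i * cnj (v $ j)))"
  by (simp add: rank_one_proj_def matrix_matrix_mult_def cinner_def vec_eq_iff sum_distrib_right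
      sum_distrib_left mult_ac)

lemma orthonormal_rank_one_proj_mult:
  assumes "orthonormal_basis u"
  shows "rank_one_proj (u i) ** rank_one_proj (u j) = (if i = j then rank_one_proj (u i) else 0)"
  using assms unfolding rank_one_proj_mult
  by (simp add: orthonormal_basis_def rank_one_proj_def vec_eq_iff)

lemma pvm_sum_square:
  fixes x :: "'n::finite \<Rightarrow> real"
  assumes "orthonormal_basis u"
  defines "X \<equiv> (\<Sum>i\<in>UNIV. x i *\<^sub>R rank_one_proj (u i))"
  shows "X ** X = (\<Sum>i\<in>UNIV. (x i)\<^sup>2 *\<^sub>R rank_one_proj (u i))"
  unfolding X_def cmat_mult.sum_left cmat_mult.sum_right
  by (simp add: cmat_mult.scaleR_left cmat_mult.scaleR_right
      orthonormal_rank_one_proj_mult[OF assms(1)] if_distrib power2_eq_square cong: if_cong)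

text \<open>The coefficients \<open>x\<close> are left free for two uses: the ratios
  \<open>t_ratio\<close> make the last sum vanish, while the eigenvalues of the Lyapunov solution
  give a lower bound, since that sum is nonnegative.\<close>

lemma pvm_divergence_eq:
  fixes R S :: "complex^'n^'n" and x :: "'n \<Rightarrow> real"
  assumes R: "density_operator R" and S: "density_operator S" "posdef S" and u: "orthonormal_basis u"
  defines "P \<equiv> \<lambda>i. rank_one_proj (u i)"
  defines "X \<equiv> (\<Sum>i\<in>UNIV. x i *\<^sub>R P i)"
  shows "F_pvm h1 R S P = 2 * inner R X - inner S (X ** X) - 1
    + (\<Sum>i\<in>UNIV. inner S (P i) * (inner R (P i) / inner S (P i) - x i)\<^sup>2)"
proof -
  have herm: "hermitian R" "hermitian S"
    using R S by (auto simp: density_operator_def psd_def)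
  define p where "p i = inner R (P i)" for i
  define q where "q i = inner S (P i)" for i
  have q0: "0 < q i" for i
    unfolding q_def P_def by (rule posdef_inner_rank_one_proj[OF S(2) orthonormal_nonzero[OF u]])
  have sump: "(\<Sum>i\<in>UNIV. p i) = 1" and sumq: "(\<Sum>i\<in>UNIV. q i) = 1"
    unfolding p_def q_def P_def inner_sum_right[symmetric] sum_rank_one_proj[OF u]
    using R S(1) by (simp_all add: density_inner_mat_1)
  have "q i * h1 (p i / q i)
      = 2 * (x i * p i) - (x i)\<^sup>2 * q i + q i * (p i / q i - x i)\<^sup>2 - 2 * p i + q i" for i
    using q0[of i] by (simp add: h1_def field_simps power2_eq_square)
  then have "F_pvm h1 R S P = 2 * (\<Sum>i\<in>UNIV. x i * p i) - (\<Sum>i\<in>UNIV. (x i)\<^sup>2 * q i)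
      + (\<Sum>i\<in>UNIV. q i * (p i / q i - x i)\<^sup>2) - 2 * (\<Sum>i\<in>UNIV. p i) + (\<Sum>i\<in>UNIV. q i)"
    by (simp add: F_pvm_def outcome_divergence_inner[OF herm] p_def[symmetric] q_def[symmetric]
        sum.distrib sum_subtractf sum_distrib_left)
  also have "(\<Sum>i\<in>UNIV. x i * p i) = inner R X"
    by (simp add: X_def inner_sum_right p_def)
  also have "(\<Sum>i\<in>UNIV. (x i)\<^sup>2 * q i) = inner S (X ** X)"
    unfolding X_def P_def pvm_sum_square[OF u] by (simp add: inner_sum_right q_def P_def)
  finally show ?thesis unfolding sump sumq by (simp add: p_def q_def)
qed

lemma pvm_divergence_Gamma:
  assumes R: "density_operator R" and S: "density_operator S" "posdef S" and P: "rank_one_pvm P"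
  defines "\<Gamma> \<equiv> Gamma_pvm R S P"
  shows "F_pvm h1 R S P = 2 * inner R \<Gamma> - inner S (\<Gamma> ** \<Gamma>) - 1" "hermitian \<Gamma>"
proof -
  obtain u where u: "orthonormal_basis u" and Pu: "P = (\<lambda>i. rank_one_proj (u i))"
    using P by (auto simp: rank_one_pvm_def)
  have herm: "madj R = R" "madj S = S"
    using R S by (auto simp: density_operator_def psd_def hermitian_def)
  show "F_pvm h1 R S P = 2 * inner R \<Gamma> - inner S (\<Gamma> ** \<Gamma>) - 1"
    unfolding \<Gamma>_def Gamma_pvm_def Pu
    by (subst pvm_divergence_eq[OF R S u, of "t_ratio R S P"])
      (simp add: t_ratio_def Re_trace_mult herm Pu)
  show "hermitian \<Gamma>"
    by (simp add: \<Gamma>_def Gamma_pvm_def Pu hermitian_def linear_sum[OF linear_madj]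
        linear_scale[OF linear_madj] hermitian_rank_one_proj[unfolded hermitian_def])
qed

text \<open>The supremum in \<open>measured_divergence\<close> runs over measurements indexed by
  initial segments of \<open>nat\<close>, whereas a PVM is indexed by the type
  \<open>'n\<close>.\<close>

lemma pvm_relabel:
  fixes P :: "'n::finite \<Rightarrow> complex^'n^'n"
  assumes "povm UNIV P"
  obtains n and M :: "nat \<Rightarrow> complex^'n^'n" where "povm {..<n} M"
    "outcome_divergence h R S {..<n} M = outcome_divergence h R S UNIV P"
proof -
  obtain f :: "nat \<Rightarrow> 'n" where f: "bij_betw f {..<CARD('n)} UNIV"
    using ex_bij_betw_nat_finite[of "UNIV :: 'n set"] by (auto simp: atLeast0LessThan)
  show thesis
  proof (rule that[of "CARD('n)" "P \<circ> f"])
    show "povm {..<CARD('n)} (P \<circ> f)"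
      using assms sum.reindex_bij_betw[OF f, of P] by (simp add: povm_def)
    show "outcome_divergence h R S {..<CARD('n)} (P \<circ> f) = outcome_divergence h R S UNIV P"
      unfolding outcome_divergence_def comp_def by (rule sum.reindex_bij_betw[OF f])
  qed
qed

text \<open>The upper bound is \<open>povm_divergence_le\<close>. For the lower one, measuring in an
  eigenbasis of \<open>X\<close> gives at least \<open>inner R X - 1\<close>, by
  \<open>pvm_divergence_eq\<close> with the eigenvalues of \<open>X\<close> as coefficients.\<close>

lemma measured_divergence_h1:
  assumes R: "density_operator R" and S: "density_operator S" "posdef S"
    and X: "hermitian_lyapunov_solution R S X"
  shows "measured_divergence h1 R S = ereal (inner R X - 1)"
proof (rule antisym)
  show "measured_divergence h1 R S \<le> ereal (inner R X - 1)"
    unfolding measured_divergence_def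
    by (rule Sup_least) (use povm_divergence_le[OF R S(1) _ X] in auto)
  have "hermitian X" using X by (simp add: hermitian_lyapunov_solution_def)
  then obtain u x where u: "orthonormal_basis u" and eig: "\<And>i. X *v u i = (x i :: real) *\<^sub>R u i"
    by (rule hermitian_spectral_theorem) blast
  define P where "P = (\<lambda>i. rank_one_proj (u i))"
  have "povm UNIV P"
    by (simp add: povm_def P_def psd_rank_one_proj sum_rank_one_proj[OF u])
  then obtain n :: nat and M where M: "povm {..<n} M"
    "outcome_divergence h1 R S {..<n} M = outcome_divergence h1 R S UNIV P"
    by (rule pvm_relabel[of P h1 R S])
  have "inner R X - 1 = 2 * inner R X - inner S (X ** X) - 1"
    using variational_identity[OF X \<open>hermitian X\<close>] by simp
  also have "\<dots> \<le> F_pvm h1 R S P"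
  proof -
    have "0 \<le> (\<Sum>i\<in>UNIV. inner S (P i) * (inner R (P i) / inner S (P i) - x i)\<^sup>2)"
      using posdef_inner_rank_one_proj[OF S(2) orthonormal_nonzero[OF u]]
      by (intro sum_nonneg mult_nonneg_nonneg) (auto simp: P_def less_imp_le)
    then show ?thesis
      using pvm_divergence_eq[OF R S u, of x] spectral_sum[OF u eig] by (simp add: P_def)
  qed
  also have "\<dots> = outcome_divergence h1 R S {..<n} M"
    by (simp add: F_pvm_def M)
  finally show "ereal (inner R X - 1) \<le> measured_divergence h1 R S"
    unfolding measured_divergence_def using M(1)
    by (intro Sup_upper2[of "ereal (outcome_divergence h1 R S {..<n} M)"]) auto
qed

subsection \<open>Block decomposition\<close>

text \<open>Pythagoras on each side: for a Hermitian idempotent, the squared norm of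
  \<open>B \<alpha> ** A\<close> is \<open>inner A (B \<alpha> ** A)\<close>, and these sum to the
  squared norm of \<open>A\<close>.\<close>

lemma norm_block_decomposition:
  fixes A :: "complex^'n^'n" and B :: "'i \<Rightarrow> complex^'n^'n"
  assumes proj: "\<And>\<alpha>. \<alpha> \<in> I \<Longrightarrow> hermitian (B \<alpha>) \<and> B \<alpha> ** B \<alpha> = B \<alpha>" and sum1: "(\<Sum>\<alpha>\<in>I. B \<alpha>) = mat 1"
  shows "(norm A)\<^sup>2 = (\<Sum>\<alpha>\<in>I. \<Sum>\<beta>\<in>I. (norm (B \<alpha> ** A ** B \<beta>))\<^sup>2)"
proof -
  have left: "(norm A)\<^sup>2 = (\<Sum>\<alpha>\<in>I. (norm (B \<alpha> ** A))\<^sup>2)" for A :: "complex^'n^'n"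
  proof -
    have "(\<Sum>\<alpha>\<in>I. (norm (B \<alpha> ** A))\<^sup>2) = (\<Sum>\<alpha>\<in>I. inner A (B \<alpha> ** A))"
      using proj
      by (intro sum.cong refl)
        (simp add: power2_norm_eq_inner inner_mult_left[of _ A] hermitian_def matrix_mul_assoc)
    also have "\<dots> = inner A ((\<Sum>\<alpha>\<in>I. B \<alpha>) ** A)"
      by (simp add: inner_sum_right cmat_mult.sum_left)
    finally show ?thesis by (simp add: sum1 power2_norm_eq_inner)
  qed
  have right: "(norm A)\<^sup>2 = (\<Sum>\<beta>\<in>I. (norm (A ** B \<beta>))\<^sup>2)" for A :: "complex^'n^'n"
  proof -
    have "(\<Sum>\<beta>\<in>I. (norm (A ** B \<beta>))\<^sup>2) = (\<Sum>\<beta>\<in>I. inner A (A ** B \<beta>))"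
      using proj
      by (intro sum.cong refl)
        (simp add: power2_norm_eq_inner inner_mult_right[of A] hermitian_def
          matrix_mul_assoc[symmetric])
    also have "\<dots> = inner A (A ** (\<Sum>\<beta>\<in>I. B \<beta>))"
      by (simp add: inner_sum_right cmat_mult.sum_right)
    finally show ?thesis by (simp add: sum1 power2_norm_eq_inner)
  qed
  show ?thesis
    using left[of A] right[of "B _ ** A"] by simp
qed

lemma spectral_decomposition_mult:
  assumes dec: "spectral_decomposition A m s B" and \<alpha>: "\<alpha> \<in> {1..m}"
  shows "B \<alpha> ** A = s \<alpha> *\<^sub>R B \<alpha>" "A ** B \<alpha> = s \<alpha> *\<^sub>R B \<alpha>"
proof -
  have A: "A = (\<Sum>\<beta>=1..m. s \<beta> *\<^sub>R B \<beta>)" and idem: "B \<alpha> ** B \<alpha> = B \<alpha>"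
    and ortho: "\<And>\<beta>. \<beta> \<in> {1..m} \<Longrightarrow> \<beta> \<noteq> \<alpha> \<Longrightarrow> B \<alpha> ** B \<beta> = 0 \<and> B \<beta> ** B \<alpha> = 0"
    using dec \<alpha> by (auto simp: spectral_decomposition_def)
  have "B \<alpha> ** A = (\<Sum>\<beta>=1..m. if \<beta> = \<alpha> then s \<alpha> *\<^sub>R B \<alpha> else 0)"
    unfolding A cmat_mult.sum_right
    by (intro sum.cong refl) (simp add: cmat_mult.scaleR_right idem ortho)
  then show "B \<alpha> ** A = s \<alpha> *\<^sub>R B \<alpha>" using \<alpha> by simp
  have "A ** B \<alpha> = (\<Sum>\<beta>=1..m. if \<beta> = \<alpha> then s \<alpha> *\<^sub>R B \<alpha> else 0)"
    unfolding A cmat_mult.sum_left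
    by (intro sum.cong refl) (simp add: cmat_mult.scaleR_left idem ortho)
  then show "A ** B \<alpha> = s \<alpha> *\<^sub>R B \<alpha>" using \<alpha> by simp
qed

text \<open>Two distinct indices make \<open>gaps m s\<close> nonempty, so that \<open>Min\<close>
  and \<open>Max\<close> are meaningful; injectivity of \<open>s\<close> makes the minimum
  positive.\<close>

lemma gap_bounds:
  assumes "inj_on s {1..m}" "\<alpha> \<in> {1..m}" "\<beta> \<in> {1..m}" "\<alpha> \<noteq> \<beta>"
  shows "gap_min m s \<le> \<bar>s \<alpha> - s \<beta>\<bar>" "\<bar>s \<alpha> - s \<beta>\<bar> \<le> gap_max m s" "0 < gap_min m s"
proof -
  have "gaps m s \<subseteq> (\<lambda>(\<alpha>, \<beta>). \<bar>s \<alpha> - s \<beta>\<bar>) ` ({1..m} \<times> {1..m})"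
    by (auto simp: gaps_def)
  then have fin: "finite (gaps m s)"
    by (rule finite_subset) auto
  have mem: "\<bar>s \<alpha> - s \<beta>\<bar> \<in> gaps m s"
    unfolding gaps_def using assms by blast
  show "gap_min m s \<le> \<bar>s \<alpha> - s \<beta>\<bar>" "\<bar>s \<alpha> - s \<beta>\<bar> \<le> gap_max m s"
    using fin mem by (auto simp: gap_min_def gap_max_def)
  have "gap_min m s \<in> gaps m s"
    unfolding gap_min_def using fin mem by (intro Min_in) auto
  then obtain \<gamma> \<delta> where "\<gamma> \<in> {1..m}" "\<delta> \<in> {1..m}" "\<gamma> \<noteq> \<delta>" "gap_min m s = \<bar>s \<gamma> - s \<delta>\<bar>"
    unfolding gaps_def by blast
  then show "0 < gap_min m s"
    using inj_onD[OF assms(1), of \<gamma> \<delta>] by auto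
qed

text \<open>The off-diagonal part \<open>N\<close> of the squared norm and \<open>c\<^sup>2\<close>
  are sums of the same blocks, the latter with weights
  \<open>(s \<alpha> - s \<beta>)\<^sup>2\<close>; bounding the weights by the extreme gaps compares
  the two.\<close>

lemma block_norm_bounds:
  fixes R S :: "complex^'n^'n"
  assumes dec: "spectral_decomposition (Gamma_pvm R S P) m s B"
  defines "c \<equiv> c_pvm R S P" and "r \<equiv> r_pvm R S m s B"
  shows "m = 1 \<Longrightarrow> c = 0"
    and "4 * r\<^sup>2 + gap_quotient m c (gap_max m s) \<le> (norm (G_pvm R S P))\<^sup>2"
    and "(norm (G_pvm R S P))\<^sup>2 \<le> 4 * r\<^sup>2 + gap_quotient m c (gap_min m s)"
    and "c = 0 \<longleftrightarrow> gap_quotient m c (gap_max m s) = 0"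
    and "0 \<le> gap_quotient m c (gap_max m s)"
proof -
  let ?\<Gamma> = "Gamma_pvm R S P"
  let ?I = "{1..m}"
  define G where "G = G_pvm R S P"
  define n where "n \<alpha> \<beta> = (norm (B \<alpha> ** G ** B \<beta>))\<^sup>2" for \<alpha> \<beta>
  define N where "N = (\<Sum>\<alpha>\<in>?I. \<Sum>\<beta>\<in>?I. if \<alpha> = \<beta> then 0 else n \<alpha> \<beta>)"
  note \<Gamma>B = spectral_decomposition_mult[OF dec]
  have inj: "inj_on s ?I" and sum1: "(\<Sum>\<alpha>\<in>?I. B \<alpha>) = mat 1"
    and proj: "\<And>\<alpha>. \<alpha> \<in> ?I \<Longrightarrow> hermitian (B \<alpha>) \<and> B \<alpha> ** B \<alpha> = B \<alpha>"
    using dec by (auto simp: spectral_decomposition_def)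
  have n0: "0 \<le> n \<alpha> \<beta>" for \<alpha> \<beta> by (simp add: n_def)
  \<comment> \<open>Next to \<open>B \<alpha>\<close> the matrix \<open>\<Gamma>\<close> acts as the
    scalar \<open>s \<alpha>\<close>, so the block of \<open>G\<close> is twice that of
    \<open>R - s \<alpha> *\<^sub>R S\<close>; squaring gives the factor \<open>4\<close>.\<close>
  have diag: "n \<alpha> \<alpha> = 4 * (norm (B \<alpha> ** (R - s \<alpha> *\<^sub>R S) ** B \<alpha>))\<^sup>2" if "\<alpha> \<in> ?I" for \<alpha>
  proof -
    have eqs: "B \<alpha> ** (S ** ?\<Gamma>) ** B \<alpha> = B \<alpha> ** S ** (?\<Gamma> ** B \<alpha>)"
      "B \<alpha> ** (?\<Gamma> ** S) ** B \<alpha> = (B \<alpha> ** ?\<Gamma>) ** S ** B \<alpha>"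
      by (simp_all only: matrix_mul_assoc)
    have "B \<alpha> ** G ** B \<alpha> = 2 *\<^sub>R (B \<alpha> ** (R - s \<alpha> *\<^sub>R S) ** B \<alpha>)"
      unfolding G_def G_pvm_def scaleR_2
      by (simp only: cmat_mult.add_left cmat_mult.add_right cmat_mult.diff_left cmat_mult.diff_right
          cmat_mult.scaleR_left cmat_mult.scaleR_right eqs \<Gamma>B[OF that]) simp
    then show ?thesis by (simp add: n_def power_mult_distrib)
  qed
  have r: "r\<^sup>2 = (\<Sum>\<alpha>\<in>?I. (norm (B \<alpha> ** (R - s \<alpha> *\<^sub>R S) ** B \<alpha>))\<^sup>2)"
    unfolding r_def r_pvm_def hs_norm_eq_norm by (simp add: sum_nonneg)
  have G: "(norm G)\<^sup>2 = 4 * r\<^sup>2 + N"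
  proof -
    have "(norm G)\<^sup>2 = (\<Sum>\<alpha>\<in>?I. \<Sum>\<beta>\<in>?I. (if \<beta> = \<alpha> then n \<alpha> \<alpha> else 0) + (if \<alpha> = \<beta> then 0 else n \<alpha> \<beta>))"
      by (subst norm_block_decomposition[OF proj sum1]) (auto simp: n_def intro!: sum.cong)
    also have "\<dots> = (\<Sum>\<alpha>\<in>?I. n \<alpha> \<alpha>) + N"
      by (simp add: sum.distrib N_def)
    finally show ?thesis by (simp add: r sum_distrib_left diag)
  qed
  have c: "c\<^sup>2 = (\<Sum>\<alpha>\<in>?I. \<Sum>\<beta>\<in>?I. (s \<alpha> - s \<beta>)\<^sup>2 * (if \<alpha> = \<beta> then 0 else n \<alpha> \<beta>))"
  proof -
    \<comment> \<open>For \<open>\<alpha> = \<beta>\<close> the weight is zero, so replacing the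
      diagonal blocks by \<open>0\<close> changes nothing.\<close>
    have "(norm (B \<alpha> ** commutator ?\<Gamma> G ** B \<beta>))\<^sup>2 = (s \<alpha> - s \<beta>)\<^sup>2 * (if \<alpha> = \<beta> then 0 else n \<alpha> \<beta>)"
      if "\<alpha> \<in> ?I" "\<beta> \<in> ?I" for \<alpha> \<beta>
    proof -
      have "B \<alpha> ** commutator ?\<Gamma> G ** B \<beta> = (B \<alpha> ** ?\<Gamma>) ** G ** B \<beta> - B \<alpha> ** G ** (?\<Gamma> ** B \<beta>)"
        by (simp add: commutator_def cmat_mult.diff_left cmat_mult.diff_right matrix_mul_assoc)
      also have "\<dots> = (s \<alpha> - s \<beta>) *\<^sub>R (B \<alpha> ** G ** B \<beta>)"
        by (simp add: \<Gamma>B(1)[OF that(1)] \<Gamma>B(2)[OF that(2)] cmat_mult.scaleR_left cmat_mult.scaleR_right scaleR_diff_left)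
      finally show ?thesis by (simp add: n_def power_mult_distrib)
    qed
    then show ?thesis
      unfolding c_def c_pvm_def hs_norm_eq_norm G_def[symmetric]
      by (subst norm_block_decomposition[OF proj sum1]) (auto intro!: sum.cong)
  qed
  \<comment> \<open>An empty sum is not the identity. Hence \<open>m < 2\<close> means
    \<open>m = 1\<close>, where there are no off-diagonal blocks and the quotients are zero by
    convention.\<close>
  have m0: "m \<noteq> 0"
  proof
    assume "m = 0"
    with sum1 have "(0 :: complex^'n^'n) = mat 1" by simp
    from arg_cong[OF this, of "\<lambda>M. M $ undefined $ undefined"] show False
      by (simp add: mat_def)
  qed
  have N0: "0 \<le> N" unfolding N_def by (intro sum_nonneg) (simp add: n0)
  show c1: "c = 0" if "m = 1"
    using c that by simp
  have N1: "N = 0" if "m = 1" using that by (simp add: N_def)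
  have gap_pos: "0 < gap_min m s" "0 < gap_max m s" if "2 \<le> m"
    using gap_bounds[OF inj, of 1 2] that by auto
  have up: "N \<le> gap_quotient m c (gap_min m s)"
  proof (cases "2 \<le> m")
    case True
    have "(gap_min m s)\<^sup>2 * N \<le> c\<^sup>2"
      unfolding c N_def sum_distrib_left
    proof (intro sum_mono)
      fix \<alpha> \<beta> assume *: "\<alpha> \<in> ?I" "\<beta> \<in> ?I"
      show "(gap_min m s)\<^sup>2 * (if \<alpha> = \<beta> then 0 else n \<alpha> \<beta>) \<le> (s \<alpha> - s \<beta>)\<^sup>2 * (if \<alpha> = \<beta> then 0 else n \<alpha> \<beta>)"
        using gap_bounds(1)[OF inj *] gap_pos(1)[OF True] n0
        by (cases "\<alpha> = \<beta>") (auto intro!: mult_right_mono simp: abs_le_square_iff[symmetric])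
    qed
    with True gap_pos(1) show ?thesis
      by (simp add: gap_quotient_def field_simps)
  next
    case False
    with m0 have "m = 1" by simp
    then show ?thesis by (simp add: N1 gap_quotient_def)
  qed
  have low: "gap_quotient m c (gap_max m s) \<le> N"
  proof (cases "2 \<le> m")
    case True
    have "c\<^sup>2 \<le> (gap_max m s)\<^sup>2 * N"
      unfolding c N_def sum_distrib_left
    proof (intro sum_mono)
      fix \<alpha> \<beta> assume *: "\<alpha> \<in> ?I" "\<beta> \<in> ?I"
      show "(s \<alpha> - s \<beta>)\<^sup>2 * (if \<alpha> = \<beta> then 0 else n \<alpha> \<beta>) \<le> (gap_max m s)\<^sup>2 * (if \<alpha> = \<beta> then 0 else n \<alpha> \<beta>)"
        using gap_bounds(2)[OF inj *] gap_pos(2)[OF True] n0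
        by (cases "\<alpha> = \<beta>") (auto intro!: mult_right_mono simp: abs_le_square_iff[symmetric])
    qed
    with True gap_pos(2) show ?thesis
      by (simp add: gap_quotient_def field_simps)
  next
    case False
    then show ?thesis by (simp add: gap_quotient_def N0)
  qed
  show "4 * r\<^sup>2 + gap_quotient m c (gap_max m s) \<le> (norm (G_pvm R S P))\<^sup>2"
    "(norm (G_pvm R S P))\<^sup>2 \<le> 4 * r\<^sup>2 + gap_quotient m c (gap_min m s)"
    using G up low by (simp_all add: G_def)
  show "0 \<le> gap_quotient m c (gap_max m s)"
    by (simp add: gap_quotient_def)
  show "c = 0 \<longleftrightarrow> gap_quotient m c (gap_max m s) = 0"
    using m0 c1 gap_pos(2) by (cases "m = 1") (auto simp: gap_quotient_def)
qed

section \<open>The optimality gap and the final estimates\<close>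

text \<open>The gap is the square term of \<open>variational_identity\<close> at
  \<open>Gamma_pvm R S P\<close>. Writing it as a pairing of \<open>E\<close> with its
  anticommutator brings it into the form treated by \<open>anticommutator_bounds\<close>.\<close>

lemma divergence_gap:
  fixes R S :: "complex^'n^'n"
  assumes R: "density_operator R" and S: "density_operator S" "posdef S" and P: "rank_one_pvm P"
    and X: "hermitian_lyapunov_solution R S X"
  defines "E \<equiv> X - Gamma_pvm R S P"
  shows "measured_divergence h1 R S - ereal (F_pvm h1 R S P) = ereal (inner E (G_pvm R S P) / 2)"
    and "S ** E + E ** S = G_pvm R S P"
proof -
  let ?\<Gamma> = "Gamma_pvm R S P"
  have mX: "madj X = X" and sol: "S ** X + X ** S = 2 *\<^sub>R R"
    using X by (auto simp: hermitian_lyapunov_solution_def hermitian_def)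
  have m\<Gamma>: "madj ?\<Gamma> = ?\<Gamma>"
    using pvm_divergence_Gamma(2)[OF R S P] by (simp add: hermitian_def)
  have mE: "madj E = E"
    by (simp add: E_def linear_diff[OF linear_madj] mX m\<Gamma>)
  show G: "S ** E + E ** S = G_pvm R S P"
    by (simp add: E_def G_pvm_def cmat_mult.diff_left cmat_mult.diff_right sol[symmetric])
  have "inner E (G_pvm R S P) = inner (S ** E + E ** S) E"
    by (simp add: G inner_commute)
  also have "\<dots> = 2 * inner S (E ** E)"
    by (simp add: inner_add_left inner_mult_right[of S E] inner_mult_left[of E S] mE)
  finally show "measured_divergence h1 R S - ereal (F_pvm h1 R S P)
      = ereal (inner E (G_pvm R S P) / 2)"
    using variational_identity[OF X pvm_divergence_Gamma(2)[OF R S P]]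
    by (simp add: measured_divergence_h1[OF R S X] pvm_divergence_Gamma(1)[OF R S P] E_def)
qed

theorem theorem5p6:
  fixes \<rho> \<sigma> :: "complex^'d::finite^'d"
    and P :: "'d \<Rightarrow> complex^'d^'d"
    and m :: nat
    and s :: "nat \<Rightarrow> real"
    and B :: "nat \<Rightarrow> complex^'d^'d"
  assumes "density_operator \<rho>" and "posdef \<rho>"
    and "density_operator \<sigma>" and "posdef \<sigma>"
    and "rank_one_pvm P"
    and "spectral_decomposition (Gamma_pvm \<rho> \<sigma> P) m s B"
  shows "(\<exists>!X. hermitian_lyapunov_solution \<rho> \<sigma> X) \<and>
    (m = 1 \<longrightarrow> c_pvm \<rho> \<sigma> P = 0) \<and>
    ereal ((4 * (r_pvm \<rho> \<sigma> m s B)\<^sup>2 + gap_quotient m (c_pvm \<rho> \<sigma> P) (gap_max m s))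
        / (4 * lambda_max \<sigma>))
      \<le> measured_divergence h1 \<rho> \<sigma> - ereal (F_pvm h1 \<rho> \<sigma> P) \<and>
    measured_divergence h1 \<rho> \<sigma> - ereal (F_pvm h1 \<rho> \<sigma> P)
      \<le> ereal ((4 * (r_pvm \<rho> \<sigma> m s B)\<^sup>2 + gap_quotient m (c_pvm \<rho> \<sigma> P) (gap_min m s))
        / (4 * lambda_min \<sigma>)) \<and>
    sqrt (4 * (r_pvm \<rho> \<sigma> m s B)\<^sup>2 + gap_quotient m (c_pvm \<rho> \<sigma> P) (gap_max m s))
        / (2 * lambda_max \<sigma>)
      \<le> hs_norm (Gamma_pvm \<rho> \<sigma> P - Gamma_star \<rho> \<sigma>) \<and>
    hs_norm (Gamma_pvm \<rho> \<sigma> P - Gamma_star \<rho> \<sigma>)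
      \<le> sqrt (4 * (r_pvm \<rho> \<sigma> m s B)\<^sup>2 + gap_quotient m (c_pvm \<rho> \<sigma> P) (gap_min m s))
        / (2 * lambda_min \<sigma>) \<and>
    (r_pvm \<rho> \<sigma> m s B = 0 \<and> c_pvm \<rho> \<sigma> P = 0 \<longleftrightarrow>
      ereal (F_pvm h1 \<rho> \<sigma> P) = measured_divergence h1 \<rho> \<sigma>)"
proof -
  note dens = assms(1,3) and pos = assms(4) and pvm = assms(5)
  define X where "X = Gamma_star \<rho> \<sigma>"
  define E where "E = X - Gamma_pvm \<rho> \<sigma> P"
  define G where "G = G_pvm \<rho> \<sigma> P"
  define r where "r = r_pvm \<rho> \<sigma> m s B"
  define c where "c = c_pvm \<rho> \<sigma> P"
  define kmax where "kmax = gap_quotient m c (gap_max m s)"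
  define kmin where "kmin = gap_quotient m c (gap_min m s)"
  have ex1: "\<exists>!X. hermitian_lyapunov_solution \<rho> \<sigma> X"
    using posdef_lyapunov_ex1[OF pos] assms(2) by (simp add: posdef_def)
  then have X: "hermitian_lyapunov_solution \<rho> \<sigma> X"
    unfolding X_def Gamma_star_def by (rule theI')
  have gap: "measured_divergence h1 \<rho> \<sigma> - ereal (F_pvm h1 \<rho> \<sigma> P) = ereal (inner E G / 2)"
    and anti: "\<sigma> ** E + E ** \<sigma> = G"
    unfolding E_def G_def by (rule divergence_gap[OF dens pos pvm X])+
  have herm: "hermitian \<sigma>" using pos by (simp add: posdef_def)
  then obtain u l where u: "orthonormal_basis u" and eig: "\<And>i. \<sigma> *v u i = (l i :: real) *\<^sub>R u i"
    by (rule hermitian_spectral_theorem) blast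
  have lmin: "lambda_min \<sigma> \<le> l i" and lmax: "l i \<le> lambda_max \<sigma>" for i
    by (simp_all add: lambda_min_def lambda_max_def real_eigenvalues_eq_range[OF u eig herm])
  have "lambda_min \<sigma> \<in> range l"
    unfolding lambda_min_def real_eigenvalues_eq_range[OF u eig herm] by (rule Min_in) auto
  then have lpos: "0 < lambda_min \<sigma>"
    using posdef_eigenvalue_pos[OF pos orthonormal_nonzero[OF u] eig] by auto
  then have Lpos: "0 < lambda_max \<sigma>"
    using lmin[of undefined] lmax[of undefined] by linarith
  \<comment> \<open>The extreme eigenvalues of \<open>\<sigma>\<close> serve as \<open>lo\<close>
    and \<open>hi\<close>; \<open>anti\<close> turns the anticommutator into
    \<open>G\<close>.\<close>
  note bounds = anticommutator_bounds[OF u eig herm lmin less_imp_le[OF lpos] lmax, of E,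
      unfolded anti]
  have m1: "m = 1 \<Longrightarrow> c = 0"
    and low: "4 * r\<^sup>2 + kmax \<le> (norm G)\<^sup>2" and up: "(norm G)\<^sup>2 \<le> 4 * r\<^sup>2 + kmin"
    and c0: "c = 0 \<longleftrightarrow> kmax = 0" and kmax0: "0 \<le> kmax"
    unfolding c_def r_def kmax_def kmin_def G_def by (rule block_norm_bounds[OF assms(6)]; assumption)+
  have div_low: "(4 * r\<^sup>2 + kmax) / (4 * lambda_max \<sigma>) \<le> inner E G / 2"
    using low bounds(1) Lpos by (simp add: field_simps)
  have div_up: "inner E G / 2 \<le> (4 * r\<^sup>2 + kmin) / (4 * lambda_min \<sigma>)"
    using up bounds(2) lpos by (simp add: field_simps)
  have norm_low: "sqrt (4 * r\<^sup>2 + kmax) / (2 * lambda_max \<sigma>) \<le> norm E"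
  proof -
    have "sqrt (4 * r\<^sup>2 + kmax) \<le> norm G"
      using low by (intro real_le_lsqrt) auto
    with bounds(3) Lpos show ?thesis by (simp add: field_simps)
  qed
  have norm_up: "norm E \<le> sqrt (4 * r\<^sup>2 + kmin) / (2 * lambda_min \<sigma>)"
  proof -
    have "norm G \<le> sqrt (4 * r\<^sup>2 + kmin)"
      using up by (rule real_le_rsqrt)
    with bounds(4) lpos show ?thesis by (simp add: field_simps)
  qed
  \<comment> \<open>If \<open>r\<close> and \<open>c\<close> vanish, both bounds on the gap are
    zero. Conversely, a zero gap makes the lower bound, a sum of nonnegative terms, vanish, and
    \<open>c0\<close> passes from \<open>kmax = 0\<close> to \<open>c = 0\<close>, also when
    \<open>m = 1\<close>.\<close>
  have optimal: "r = 0 \<and> c = 0 \<longleftrightarrow> inner E G / 2 = 0"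
  proof
    assume rc: "r = 0 \<and> c = 0"
    then have "kmin = 0" by (simp add: kmin_def gap_quotient_def)
    with rc c0 div_low div_up show "inner E G / 2 = 0" by simp
  next
    assume "inner E G / 2 = 0"
    with div_low Lpos have "4 * r\<^sup>2 + kmax \<le> 0" by (simp add: field_simps)
    with kmax0 have "r\<^sup>2 = 0" "kmax = 0"
      using zero_le_power2[of r] by linarith+
    with c0 show "r = 0 \<and> c = 0" by simp
  qed
  \<comment> \<open>The infinite cases contradict \<open>gap\<close>, whose right-hand side is a
    real number.\<close>
  have "ereal (F_pvm h1 \<rho> \<sigma> P) = measured_divergence h1 \<rho> \<sigma> \<longleftrightarrow> inner E G / 2 = 0"
    using gap by (cases "measured_divergence h1 \<rho> \<sigma>") auto
  moreover have "hs_norm (Gamma_pvm \<rho> \<sigma> P - Gamma_star \<rho> \<sigma>) = norm E"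
    by (simp add: hs_norm_eq_norm E_def X_def norm_minus_commute)
  ultimately show ?thesis
    unfolding gap r_def[symmetric] c_def[symmetric] kmax_def[symmetric] kmin_def[symmetric]
    using ex1 m1 div_low div_up norm_low norm_up optimal by simp
qed

end
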